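(* Let $F$ be an algebraically closed field of characteristic $0$, let $A$ be a finite dimensional associative $F$-algebra, and let $B_1,\ldots,B_l$ be basic algebras over $F$ such that $A$ is PI-equivalent to $B_1\times\cdots\times B_l$. Then $$\exp(A)=\max_{1\le i\le l}\exp(B_i)\qquad\text{and}\qquad t(A)=\max_j\{t(B_j) : \exp(B_j)=\exp(A)\}.$$
   Context: Algebras are associative and not necessarily unital. $F\langle X\rangle$ is the free algebra on countably many noncommuting variables; $\mathrm{Id}(A)$ is the ideal of polynomial identities of $A$; $P_n(F)=\mathrm{span}_F\{x_{\sigma(1)}\cdots x_{\sigma(n)}\mid \sigma\in S_n\}$; $c_n(A)=\dim_F P_n(F)/(P_n(F)\cap\mathrm{Id}(A))$. Two algebras are PI-equivalent if they have the same polynomial identities. By known theorems of Giambruno-Zaicev and Berele-Regev, for a finite dimensional algebra (more generally, an affine PI algebra) $W$ over $F$ the limit $\exp(W)=\lim_{n\to\infty}\sqrt[n]{c_n(W)}$ exists and is a nonnegative integer, and there are $t=t(W)\in\frac12\mathbb Z$ and constants $c_1,c_2>0$ such that $c_1n^{t}\exp(W)^n\le c_n(W)\le c_2n^{t}\exp(W)^n$ for all large $n$. The number $t(W)$ is called the polynomial part of the codimension sequence of $W$; it is uniquely determined when $\exp(W)\ge 1$ (i.e. $W$ is not nilpotent), and the formula for $t$ is understood in that case. For a finite dimensional algebra $A=A_{ss}\oplus J(A)$ ($A_{ss}$ a maximal semisimple subalgebra, $J(A)$ the Jacobson radical), let $\mathrm{Par}(A)=(\dim_F A_{ss},\ \mathrm{nildeg}(J(A))-1)$,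 where $\mathrm{nildeg}(J(A))$ is the number $m$ with $J(A)^m=0$, $J(A)^{m-1}\neq0$; parameters are ordered lexicographically. $A$ is basic if it is not PI-equivalent to any product $B_1\times\cdots\times B_l$ of finite dimensional algebras with $\mathrm{Par}(B_i)<\mathrm{Par}(A)$ for every $i$. *)

theory Defs
  imports
    "HOL-Algebra.Algebra"
    "HOL-Algebra.Algebraic_Closure_Type"
    "HOL-Combinatorics.Permutations"
begin

section \<open>Associative algebras, not necessarily unital\<close>

text \<open>
  The base field is a type \<open>'k\<close>. An algebra is a record of type
  \<open>('k, 'a) module\<close>, whose field \<open>one\<close> is never used: algebras need not have a unit.
\<close>

abbreviation base_field :: "'k::field ring"
  where "base_field \<equiv> ring_of_type_algebra"

locale assoc_algebra = Module.module "base_field :: 'k::field ring" A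
  for A :: "('k::field, 'a) module" (structure) +
  assumes mult_closed: "\<lbrakk>x \<in> carrier A; y \<in> carrier A\<rbrakk> \<Longrightarrow> x \<otimes> y \<in> carrier A"
    and mult_assoc: "\<lbrakk>x \<in> carrier A; y \<in> carrier A; z \<in> carrier A\<rbrakk>
      \<Longrightarrow> (x \<otimes> y) \<otimes> z = x \<otimes> (y \<otimes> z)"
    and mult_l_distr: "\<lbrakk>x \<in> carrier A; y \<in> carrier A; z \<in> carrier A\<rbrakk>
      \<Longrightarrow> (x \<oplus> y) \<otimes> z = x \<otimes> z \<oplus> y \<otimes> z"
    and mult_r_distr: "\<lbrakk>x \<in> carrier A; y \<in> carrier A; z \<in> carrier A\<rbrakk>
      \<Longrightarrow> z \<otimes> (x \<oplus> y) = z \<otimes> x \<oplus> z \<otimes> y"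
    and smult_mult_left: "\<lbrakk>x \<in> carrier A; y \<in> carrier A\<rbrakk>
      \<Longrightarrow> (c \<odot> x) \<otimes> y = c \<odot> (x \<otimes> y)"
    and smult_mult_right: "\<lbrakk>x \<in> carrier A; y \<in> carrier A\<rbrakk>
      \<Longrightarrow> x \<otimes> (c \<odot> y) = c \<odot> (x \<otimes> y)"

subsection \<open>Linear algebra\<close>

abbreviation subspace_of :: "'a set \<Rightarrow> ('k::field, 'a) module \<Rightarrow> bool"
  where "subspace_of H V \<equiv> submodule H base_field V"

definition lin_span :: "('k::field, 'a) module \<Rightarrow> 'a set \<Rightarrow> 'a set"
  where "lin_span V S = \<Inter>{H. subspace_of H V \<and> S \<subseteq> H}"

definition lin_indep :: "('k::field, 'a) module \<Rightarrow> 'a set \<Rightarrow> bool"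
  where "lin_indep V S \<longleftrightarrow>
    S \<subseteq> carrier V \<and> (\<forall>x\<in>S. x \<notin> lin_span V (S - {x}))"

definition is_basis :: "('k::field, 'a) module \<Rightarrow> 'a set \<Rightarrow> bool"
  where "is_basis V S \<longleftrightarrow> lin_indep V S \<and> lin_span V S = carrier V"

definition fin_dim :: "('k::field, 'a) module \<Rightarrow> bool"
  where "fin_dim V \<longleftrightarrow> (\<exists>S. finite S \<and> is_basis V S)"

definition dimension_of :: "('k::field, 'a) module \<Rightarrow> nat"
  where "dimension_of V = card (SOME S. is_basis V S)"

text \<open>
  The quotient space \<open>V / W\<close>. Only its vector space structure is meaningful.
\<close>

definition quotient_space :: "('k::field, 'a) module \<Rightarrow> 'a set \<Rightarrow> ('k, 'a set) module"
  where "quotient_space V W =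
    \<lparr>carrier = a_rcosets\<^bsub>V\<^esub> W,
     monoid.mult = undefined,
     one = undefined,
     ring.zero = W,
     add = set_add V,
     module.smult = (\<lambda>c U. \<Union>x\<in>U. W +>\<^bsub>V\<^esub> (c \<odot>\<^bsub>V\<^esub> x))\<rparr>"

definition fd_algebra :: "('k::field, 'a) module \<Rightarrow> bool"
  where "fd_algebra A \<longleftrightarrow> assoc_algebra A \<and> fin_dim A"

definition prod_algebra :: "'i set \<Rightarrow> ('i \<Rightarrow> ('k::field, 'a) module) \<Rightarrow> ('k, 'i \<Rightarrow> 'a) module"
  where "prod_algebra I B =
    \<lparr>carrier = (\<Pi>\<^sub>E i\<in>I. carrier (B i)),
     monoid.mult = (\<lambda>x y. \<lambda>i\<in>I. x i \<otimes>\<^bsub>B i\<^esub> y i),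
     one = (\<lambda>i\<in>I. \<one>\<^bsub>B i\<^esub>),
     ring.zero = (\<lambda>i\<in>I. \<zero>\<^bsub>B i\<^esub>),
     add = (\<lambda>x y. \<lambda>i\<in>I. x i \<oplus>\<^bsub>B i\<^esub> y i),
     module.smult = (\<lambda>c x. \<lambda>i\<in>I. c \<odot>\<^bsub>B i\<^esub> x i)\<rparr>"

section \<open>Polynomial identities and codimensions\<close>

text \<open>
  The free nonunital algebra on variables indexed by \<open>nat\<close>: a word \<open>[i\<^sub>1, \<dots>, i\<^sub>n]\<close> stands for the
  monomial \<open>x i\<^sub>1 \<cdots> x i\<^sub>n\<close>, and a polynomial is its finitely supported family of coefficients.
  The empty word is excluded since polynomials have no constant term.
\<close>

definition free_algebra :: "('k::field, nat list \<Rightarrow> 'k) module"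
  where "free_algebra =
    \<lparr>carrier = {f. finite {w. f w \<noteq> 0} \<and> f [] = 0},
     monoid.mult = (\<lambda>f g w. \<Sum>k\<le>length w. f (take k w) * g (drop k w)),
     one = undefined,
     ring.zero = (\<lambda>w. 0),
     add = (\<lambda>f g w. f w + g w),
     module.smult = (\<lambda>c f w. c * f w)\<rparr>"

definition monomial_of :: "nat list \<Rightarrow> nat list \<Rightarrow> 'k::field"
  where "monomial_of w = (\<lambda>v. if v = w then 1 else 0)"

text \<open>The value at the empty word is irrelevant.\<close>

fun word_value :: "('k::field, 'a) module \<Rightarrow> (nat \<Rightarrow> 'a) \<Rightarrow> nat list \<Rightarrow> 'a" where
  "word_value A a [] = \<zero>\<^bsub>A\<^esub>"
| "word_value A a [i] = a i"
| "word_value A a (i # j # w) = a i \<otimes>\<^bsub>A\<^esub> word_value A a (j # w)"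

definition poly_value ::
    "('k::field, 'a) module \<Rightarrow> (nat \<Rightarrow> 'a) \<Rightarrow> (nat list \<Rightarrow> 'k) \<Rightarrow> 'a"
  where "poly_value A a f =
    (\<Oplus>\<^bsub>A\<^esub>w\<in>{w. f w \<noteq> 0}. f w \<odot>\<^bsub>A\<^esub> word_value A a w)"

definition identities :: "('k::field, 'a) module \<Rightarrow> (nat list \<Rightarrow> 'k) set"
  where "identities A =
    {f \<in> carrier free_algebra. \<forall>a \<in> UNIV \<rightarrow> carrier A. poly_value A a f = \<zero>\<^bsub>A\<^esub>}"

definition pi_equivalent :: "('k::field, 'a) module \<Rightarrow> ('k, 'b) module \<Rightarrow> bool"
  where "pi_equivalent A B \<longleftrightarrow> identities A = identities B"

text \<open>
  Meaningful for \<open>n \<ge> 1\<close> only, since for \<open>n = 0\<close> the word is empty; the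
  index \<open>0\<close> plays no role in the asymptotic notions below.
\<close>

definition multilinear_space :: "nat \<Rightarrow> (nat list \<Rightarrow> 'k::field) set"
  where "multilinear_space n =
    lin_span free_algebra {monomial_of (map \<sigma> [1..<Suc n]) | \<sigma>. \<sigma> permutes {1..n}}"

definition codim :: "('k::field, 'a) module \<Rightarrow> nat \<Rightarrow> nat"
  where "codim A n =
    dimension_of (quotient_space (free_algebra\<lparr>carrier := multilinear_space n\<rparr>)
      (multilinear_space n \<inter> identities A))"

definition pi_exp :: "('k::field, 'a) module \<Rightarrow> real"
  where "pi_exp A = lim (\<lambda>n. root n (real (codim A n)))"

definition is_poly_part :: "('k::field, 'a) module \<Rightarrow> real \<Rightarrow> bool"
  where "is_poly_part A t \<longleftrightarrow> 2 * t \<in> \<int> \<and>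
    (\<exists>c1 c2. 0 < c1 \<and> 0 < c2 \<and>
      (\<forall>\<^sub>F n in sequentially.
        c1 * real n powr t * pi_exp A ^ n \<le> real (codim A n) \<and>
        real (codim A n) \<le> c2 * real n powr t * pi_exp A ^ n))"

text \<open>Well defined only if \<open>pi_exp A \<ge> 1\<close>; for nilpotent algebras \<open>t\<close> is not unique.\<close>

definition poly_part :: "('k::field, 'a) module \<Rightarrow> real"
  where "poly_part A = (THE t. is_poly_part A t)"

text \<open>
  Existence of the exponent and of the polynomial part. By theorems of Giambruno and Zaicev and
  of Berele and Regev this holds for every finite dimensional algebra over an algebraically closed
  field of characteristic \<open>0\<close> (where moreover the exponent is an integer).
\<close>

definition regular_codim_growth :: "('k::field, 'a) module \<Rightarrow> bool"
  where "regular_codim_growth A \<longleftrightarrow>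
    convergent (\<lambda>n. root n (real (codim A n))) \<and> (\<exists>t. is_poly_part A t)"

section \<open>Parameters and basic algebras\<close>

definition left_ideal :: "('k::field, 'a) module \<Rightarrow> 'a set \<Rightarrow> bool"
  where "left_ideal A I \<longleftrightarrow>
    subspace_of I A \<and> (\<forall>a\<in>carrier A. \<forall>x\<in>I. a \<otimes>\<^bsub>A\<^esub> x \<in> I)"

text \<open>
  A left ideal is modular if it has a right unit modulo itself. In the absence of a unit element,
  the Jacobson radical is the intersection of the maximal left ideals that are modular
  (the whole algebra if there are none).
\<close>

definition modular_left_ideal :: "('k::field, 'a) module \<Rightarrow> 'a set \<Rightarrow> bool"
  where "modular_left_ideal A I \<longleftrightarrow> left_ideal A I \<and>
    (\<exists>e\<in>carrier A. \<forall>a\<in>carrier A. a \<ominus>\<^bsub>A\<^esub> (a \<otimes>\<^bsub>A\<^esub> e) \<in> I)"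

definition maximal_left_ideal :: "('k::field, 'a) module \<Rightarrow> 'a set \<Rightarrow> bool"
  where "maximal_left_ideal A I \<longleftrightarrow> left_ideal A I \<and> I \<noteq> carrier A \<and>
    (\<forall>I'. left_ideal A I' \<and> I \<subseteq> I' \<longrightarrow> I' = I \<or> I' = carrier A)"

definition jacobson_radical :: "('k::field, 'a) module \<Rightarrow> 'a set"
  where "jacobson_radical A =
    carrier A \<inter> \<Inter>{I. modular_left_ideal A I \<and> maximal_left_ideal A I}"

text \<open>\<open>alg_power A I m\<close> is the span of the products of \<open>m\<close> elements of \<open>I\<close>.\<close>

fun alg_power :: "('k::field, 'a) module \<Rightarrow> 'a set \<Rightarrow> nat \<Rightarrow> 'a set" where
  "alg_power A I 0 = carrier A"
| "alg_power A I (Suc 0) = I"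
| "alg_power A I (Suc (Suc m)) =
    lin_span A {x \<otimes>\<^bsub>A\<^esub> y | x y. x \<in> alg_power A I (Suc m) \<and> y \<in> I}"

text \<open>The nilpotency degree of \<open>0\<close> is \<open>1\<close>.\<close>

definition nildeg :: "('k::field, 'a) module \<Rightarrow> 'a set \<Rightarrow> nat"
  where "nildeg A I = (LEAST m. 1 \<le> m \<and> alg_power A I m = {\<zero>\<^bsub>A\<^esub>})"

definition semisimple_subalgebra :: "('k::field, 'a) module \<Rightarrow> 'a set \<Rightarrow> bool"
  where "semisimple_subalgebra A S \<longleftrightarrow> subspace_of S A \<and>
    (\<forall>x\<in>S. \<forall>y\<in>S. x \<otimes>\<^bsub>A\<^esub> y \<in> S) \<and>
    jacobson_radical (A\<lparr>carrier := S\<rparr>) = {\<zero>\<^bsub>A\<^esub>}"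

definition semisimple_part :: "('k::field, 'a) module \<Rightarrow> 'a set \<Rightarrow> bool"
  where "semisimple_part A S \<longleftrightarrow> semisimple_subalgebra A S \<and>
    (\<forall>S'. semisimple_subalgebra A S' \<and> S \<subseteq> S' \<longrightarrow> S' = S) \<and>
    S <+>\<^bsub>A\<^esub> jacobson_radical A = carrier A \<and> S \<inter> jacobson_radical A = {\<zero>\<^bsub>A\<^esub>}"

text \<open>
  The semisimple part exists by Wedderburn's principal theorem; all choices have the same dimension.
\<close>

definition Par :: "('k::field, 'a) module \<Rightarrow> nat \<times> nat"
  where "Par A =
    (dimension_of (A\<lparr>carrier := (SOME S. semisimple_part A S)\<rparr>),
     nildeg A (jacobson_radical A) - 1)"

text \<open>
  The algebras \<open>C i\<close> range over carriers inside \<open>nat \<Rightarrow> 'k\<close>, a type which contains an isomorphic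
  copy of every finite dimensional algebra over \<open>'k\<close>.
\<close>

definition basic_algebra :: "('k::field, 'a) module \<Rightarrow> bool"
  where "basic_algebra A \<longleftrightarrow> fd_algebra A \<and>
    \<not> (\<exists>(l::nat) (C :: nat \<Rightarrow> ('k, nat \<Rightarrow> 'k) module).
        1 \<le> l \<and>
        (\<forall>i\<in>{1..l}. fd_algebra (C i) \<and> (Par (C i), Par A) \<in> less_than <*lex*> less_than) \<and>
        pi_equivalent A (prod_algebra {1..l} C))"

end

theory Submission
  imports Defs "HOL-Library.Function_Algebras" "HOL-Real_Asymp.Real_Asymp"
begin

text \<open>
  Let \<open>P\<close> be the space of multilinear polynomials of degree \<open>n\<close>, so that the codimension of an
  algebra at \<open>n\<close> is the dimension of \<open>P\<close> modulo the identities of the algebra. A polynomial is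
  an identity of a product exactly if it is an identity of every factor
  (\<open>identities_prod_algebra\<close>). Hence, if \<open>A\<close> is PI-equivalent to the product of the \<open>B i\<close>, the
  quotient for \<open>A\<close> maps onto the quotient for each \<open>B i\<close> and embeds into the direct sum of all of
  them. Its codimension sequence is therefore at least each of the codimension sequences of the \<open>B i\<close>
  and at most their sum (\<open>codim_bounds\<close>).

  The rest is elementary analysis of a sequence squeezed in this way between finitely many sequences
  and their sum. Its \<open>n\<close>-th root tends to the largest of the limits of the \<open>n\<close>-th roots
  (\<open>root_tendsto_Max\<close>), and if the sequences grow like \<open>n powr t i * e i ^ n\<close>, then the sum
  is dominated by the terms with the largest \<open>e i\<close> and, among these, by those with the largest
  \<open>t i\<close> (\<open>poly_growth_Max\<close>). The exponent \<open>t\<close> is determined by the sequence as soon as the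
  exponential rate is positive (\<open>poly_growth_unique\<close>), so the polynomial part of \<open>A\<close> is this
  maximum.

  The linear algebra of modules given by records is reduced to the theory of \<open>vector_space\<close>. A
  record that is coordinatized by a subspace of such a space (\<open>linear_coordinates\<close>) has the
  dimension of that subspace; a quotient is coordinatized by a complement.
\<close>


section \<open>Dimensions of subspaces and their intersections\<close>

context vector_space
begin

text \<open>
  A basis of \<open>W\<close> extends to a basis of \<open>P\<close>; the added vectors span a complement.
\<close>

lemma complement_exists:
  assumes "subspace W" "subspace P" "W \<subseteq> P"
  obtains C where "subspace C" "C \<subseteq> P" "W \<inter> C = {0}" "P = {w + c | w c. w \<in> W \<and> c \<in> C}"
proof -
  obtain B where B: "B \<subseteq> W" "independent B" "W \<subseteq> span B"
    using maximal_independent_subset by blast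
  obtain B' where B': "B \<subseteq> B'" "B' \<subseteq> P" "independent B'" "P \<subseteq> span B'"
    using maximal_independent_subset_extend[of B P] B assms by blast
  have W: "W = span B" and P: "P = span B'"
    using B B' assms span_minimal by blast+
  have "x = 0" if "x \<in> span B" "x \<in> span (B' - B)" for x
  proof -
    have "representation B' x = representation B x"
      "representation B' x = representation (B' - B) x"
      using that B' by (auto intro!: representation_extend)
    hence "representation B' x b = 0" for b
      using representation_ne_zero[of B x b] representation_ne_zero[of "B' - B" x b] by auto
    moreover have "x \<in> span B'"
      using that(1) B'(1) span_mono by blast
    ultimately show ?thesis
      using sum_nonzero_representation_eq[OF B'(3), of x] by simp
  qed
  hence "W \<inter> span (B' - B) = {0}"
    unfolding W using span_zero by blast
  moreover have "P = {w + c | w c. w \<in> W \<and> c \<in> span (B' - B)}"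
    unfolding W P using span_Un[of B "B' - B"] B'(1) by (auto simp: Un_absorb1)
  moreover have "span (B' - B) \<subseteq> P"
    unfolding P by (intro span_mono) blast
  ultimately show thesis
    using that[of "span (B' - B)"] by simp
qed

text \<open>
  The union of bases of the two summands is independent: a vanishing combination splits into a
  vector of \<open>U\<close> and its negative in \<open>W\<close>, so that both lie in \<open>U \<inter> W\<close>. The
  bases are finite because of \<open>S\<close>: the space of all polynomials, to which this is applied, has
  infinite dimension.
\<close>

lemma dim_direct_sum:
  assumes "subspace U" "subspace W" "U \<inter> W = {0}" "U \<subseteq> span S" "W \<subseteq> span S" "finite S"
  shows "dim {u + w | u w. u \<in> U \<and> w \<in> W} = dim U + dim W"
proof -
  obtain B where B: "B \<subseteq> U" "independent B" "U \<subseteq> span B" "card B = dim U"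
    using basis_exists by blast
  obtain D where D: "D \<subseteq> W" "independent D" "W \<subseteq> span D" "card D = dim W"
    using basis_exists by blast
  have U: "U = span B" and W: "W = span D"
    using B D assms span_minimal by blast+
  have fin: "finite B" "finite D"
    using independent_span_bound[OF assms(6) B(2)] independent_span_bound[OF assms(6) D(2)]
      B(1) D(1) assms(4,5) by simp_all
  have "0 \<notin> B"
    using B(2) by (auto dest: dependent_zero)
  moreover have "B \<inter> D \<subseteq> {0}"
    using B(1) D(1) unfolding assms(3)[symmetric] by blast
  ultimately have disj: "B \<inter> D = {}"
    by blast
  have "independent (B \<union> D)"
  proof
    assume "dependent (B \<union> D)"
    then obtain u v where v: "v \<in> B \<union> D" "u v \<noteq> 0"
      and "(\<Sum>v\<in>B \<union> D. scale (u v) v) = 0"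
      using dependent_finite fin by (metis finite_UnI)
    hence *: "(\<Sum>v\<in>B. scale (u v) v) + (\<Sum>v\<in>D. scale (u v) v) = 0"
      using fin disj by (simp add: sum.union_disjoint)
    have "(\<Sum>v\<in>B. scale (u v) v) \<in> U"
      unfolding U by (intro span_sum span_scale span_base)
    moreover have "(\<Sum>v\<in>D. scale (u v) v) \<in> W"
      unfolding W by (intro span_sum span_scale span_base)
    moreover have "(\<Sum>v\<in>B. scale (u v) v) = - (\<Sum>v\<in>D. scale (u v) v)"
      using * by (simp add: eq_neg_iff_add_eq_0)
    ultimately have "(\<Sum>v\<in>B. scale (u v) v) \<in> U \<inter> W"
      using subspace_neg[OF assms(2)] by (simp only: Int_iff)
    hence "(\<Sum>v\<in>B. scale (u v) v) = 0"
      unfolding assms(3) by (simp only: singleton_iff)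
    moreover from this * have "(\<Sum>v\<in>D. scale (u v) v) = 0"
      by simp
    ultimately show False
      using v B(2) D(2) fin dependent_finite by (metis Un_iff)
  qed
  moreover have "span {u + w | u w. u \<in> U \<and> w \<in> W} = span (B \<union> D)"
    unfolding span_Un U W by (simp only: span_span flip: span_Un)
  ultimately have "dim {u + w | u w. u \<in> U \<and> w \<in> W} = card (B \<union> D)"
    by (intro dim_eq_card) simp_all
  thus ?thesis
    using fin disj B(4) D(4) by (simp add: card_Un_disjoint)
qed

lemma dim_complement:
  assumes "subspace W" "subspace C" "W \<inter> C = {0}" "P = {w + c | w c. w \<in> W \<and> c \<in> C}"
    and "P \<subseteq> span S" "finite S"
  shows "dim P = dim W + dim C"
proof -
  have "W \<subseteq> P" "C \<subseteq> P"
    using assms(1,2,4) subspace_0 by force+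
  thus ?thesis
    unfolding assms(4) using assms by (intro dim_direct_sum[of _ _ S]) auto
qed

lemma dim_subspace_mono:
  assumes "subspace W" "subspace P" "W \<subseteq> P" "P \<subseteq> span S" "finite S"
  shows "dim W \<le> dim P"
proof -
  obtain C where "subspace C" "W \<inter> C = {0}" "P = {w + c | w c. w \<in> W \<and> c \<in> C}"
    using complement_exists[OF assms(1-3)] .
  thus ?thesis
    using dim_complement[OF assms(1) _ _ _ assms(4,5)] by simp
qed

text \<open>
  Codimensions, written as differences of dimensions, are subadditive: a complement \<open>E\<close> of
  \<open>V \<inter> W\<close> in \<open>V\<close> meets \<open>W\<close> trivially, so that it embeds into a complement of \<open>W\<close> in
  \<open>P\<close>. Equivalently, \<open>P / (V \<inter> W)\<close> embeds into \<open>P / V \<times> P / W\<close>.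
\<close>

lemma dim_diff_Int_le:
  assumes "subspace V" "subspace W" "subspace P" "V \<subseteq> P" "W \<subseteq> P" "P \<subseteq> span S" "finite S"
  shows "dim P - dim (V \<inter> W) \<le> (dim P - dim V) + (dim P - dim W)"
proof -
  have "subspace (V \<inter> W)"
    using assms by (simp add: subspace_inter)
  then obtain E where E: "subspace E" "E \<subseteq> V" "(V \<inter> W) \<inter> E = {0}"
      "V = {w + c | w c. w \<in> V \<inter> W \<and> c \<in> E}"
    using complement_exists[of "V \<inter> W" V] assms by blast
  have V: "dim V = dim (V \<inter> W) + dim E"
    using dim_complement[OF _ E(1,3,4)] \<open>subspace (V \<inter> W)\<close> assms by blast
  have sub: "{e + w | e w. e \<in> E \<and> w \<in> W} \<subseteq> P"
    using assms E(2) by (auto intro!: subspace_add[OF assms(3)])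
  have "E \<inter> W = {0}"
    using E(2,3) by auto
  hence "dim E + dim W = dim {e + w | e w. e \<in> E \<and> w \<in> W}"
    using assms E(2) by (intro dim_direct_sum[symmetric, of _ _ S] E(1)) auto
  also have "\<dots> \<le> dim P"
    using sub assms E(1) by (intro dim_subspace_mono[of _ _ S] subspace_sums) auto
  finally show ?thesis
    using V by linarith
qed

lemma dim_diff_INT_le:
  assumes "finite I" "\<And>i. i \<in> I \<Longrightarrow> subspace (W i)" "subspace P" "P \<subseteq> span S" "finite S"
  shows "dim P - dim (P \<inter> (\<Inter>i\<in>I. W i)) \<le> (\<Sum>i\<in>I. dim P - dim (P \<inter> W i))"
  using assms(1,2)
proof (induction I rule: finite_induct)
  case empty
  then show ?case by simp
next
  case (insert i I)
  have "P \<inter> (\<Inter>j\<in>insert i I. W j) = (P \<inter> W i) \<inter> (P \<inter> (\<Inter>j\<in>I. W j))"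
    by auto
  moreover have "subspace (P \<inter> W i)" "subspace (P \<inter> (\<Inter>j\<in>I. W j))"
    using insert.prems assms(3) by (simp_all add: subspace_inter subspace_Int)
  ultimately have "dim P - dim (P \<inter> (\<Inter>j\<in>insert i I. W j))
      \<le> (dim P - dim (P \<inter> W i)) + (dim P - dim (P \<inter> (\<Inter>j\<in>I. W j)))"
    using dim_diff_Int_le[OF _ _ assms(3) Int_lower1 Int_lower1 assms(4,5)] by presburger
  moreover have "dim P - dim (P \<inter> (\<Inter>j\<in>I. W j)) \<le> (\<Sum>j\<in>I. dim P - dim (P \<inter> W j))"
    using insert by simp
  ultimately show ?case
    using insert.hyps by simp
qed

end

section \<open>Coordinates for vector spaces given by records\<close>

text \<open>
  The map \<open>q\<close> identifies the subspace \<open>P\<close> of the vector space \<open>'v\<close> with the vector space that the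
  record \<open>M\<close> describes, so that spans, independence and dimension in \<open>M\<close> can be computed in
  \<open>'v\<close>.
\<close>

locale linear_coordinates = vector_space scale
  for scale :: "'k::field \<Rightarrow> 'v::ab_group_add \<Rightarrow> 'v" +
  fixes M :: "('k, 'c) module" and P :: "'v set" and q :: "'v \<Rightarrow> 'c"
  assumes subspace_P: "subspace P"
    and bij: "bij_betw q P (carrier M)"
    and q_zero: "q 0 = \<zero>\<^bsub>M\<^esub>"
    and q_add: "\<lbrakk>x \<in> P; y \<in> P\<rbrakk> \<Longrightarrow> q (x + y) = q x \<oplus>\<^bsub>M\<^esub> q y"
    and q_scale: "x \<in> P \<Longrightarrow> q (scale c x) = c \<odot>\<^bsub>M\<^esub> q x"
begin

lemma carrier_eq: "carrier M = q ` P"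
  using bij by (simp add: bij_betw_def)

lemma inj_q: "inj_on q P"
  using bij by (simp add: bij_betw_def)

lemma P_closed [simp]: "0 \<in> P" "\<lbrakk>x \<in> P; y \<in> P\<rbrakk> \<Longrightarrow> x + y \<in> P" "x \<in> P \<Longrightarrow> scale c x \<in> P"
  using subspace_P by (auto simp: subspace_0 subspace_add subspace_scale)

lemma is_module: "Module.module base_field M"
proof (rule moduleI)
  show "cring (base_field :: 'k ring)" ..
  show "abelian_group M"
  proof (rule abelian_groupI)
    fix x assume "x \<in> carrier M"
    then obtain v where v: "v \<in> P" "x = q v"
      by (auto simp: carrier_eq)
    hence "- v \<in> P" "q (- v) \<oplus>\<^bsub>M\<^esub> x = \<zero>\<^bsub>M\<^esub>"
      using subspace_neg[OF subspace_P v(1)] by (auto simp: q_zero simp flip: q_add)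
    thus "\<exists>y\<in>carrier M. y \<oplus>\<^bsub>M\<^esub> x = \<zero>\<^bsub>M\<^esub>"
      by (auto simp: carrier_eq)
  qed (auto simp: carrier_eq add_ac simp flip: q_add q_zero)
qed (auto simp: carrier_eq ring_of_type_algebra_def algebra_simps simp flip: q_add q_scale)

text \<open>
  Submodules contain additive inverses in the sense of the record \<open>M\<close>, which are identified
  here with the images of inverses in \<open>'v\<close>.
\<close>

lemma subspace_of_iff: "subspace_of H M \<longleftrightarrow> (\<exists>K. subspace K \<and> K \<subseteq> P \<and> H = q ` K)"
proof
  interpret M: Module.module base_field M by (rule is_module)
  assume H: "subspace_of H M"
  note E = M.submoduleE[OF H]
  have zero: "\<zero>\<^bsub>M\<^esub> \<in> H"
    using submodule.axioms(1)[OF H] subgroup.one_closed by fastforce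
  let ?K = "{x \<in> P. q x \<in> H}"
  have "subspace ?K"
    using zero E(4,5) by (intro subspaceI) (auto simp: q_zero q_add q_scale ring_of_type_algebra_def)
  moreover have "H = q ` ?K"
    using E(1) by (auto simp: carrier_eq)
  ultimately show "\<exists>K. subspace K \<and> K \<subseteq> P \<and> H = q ` K"
    by (intro exI[of _ ?K]) auto
next
  interpret M: Module.module base_field M by (rule is_module)
  assume "\<exists>K. subspace K \<and> K \<subseteq> P \<and> H = q ` K"
  then obtain K where K: "subspace K" "K \<subseteq> P" "H = q ` K" by blast
  show "subspace_of H M"
  proof (rule M.submoduleI)
    show "H \<subseteq> carrier M" "\<zero>\<^bsub>M\<^esub> \<in> H"
      using K subspace_0[OF K(1)] by (auto simp: carrier_eq simp flip: q_zero)
    fix a assume "a \<in> H"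
    then obtain v where v: "v \<in> K" "a = q v" "- v \<in> K"
      using K subspace_neg by auto
    hence "q (- v) \<oplus>\<^bsub>M\<^esub> a = \<zero>\<^bsub>M\<^esub>"
      using K by (auto simp: q_zero subset_iff simp flip: q_add)
    hence "\<ominus>\<^bsub>M\<^esub> a = q (- v)"
      using v K by (intro M.minus_equality) (auto simp: carrier_eq)
    thus "\<ominus>\<^bsub>M\<^esub> a \<in> H"
      using v K by blast
  next
    fix a b assume "a \<in> H" "b \<in> H"
    then obtain v w where "v \<in> K" "w \<in> K" "a = q v" "b = q w"
      using K by auto
    moreover from this have "v + w \<in> K"
      using K subspace_add by blast
    moreover have "a \<oplus>\<^bsub>M\<^esub> b = q (v + w)"
      using calculation K by (subst q_add) auto
    ultimately show "a \<oplus>\<^bsub>M\<^esub> b \<in> H"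
      using K by blast
  next
    fix c :: 'k and a assume "a \<in> H"
    then obtain v where "v \<in> K" "a = q v"
      using K by auto
    moreover from this have "scale c v \<in> K"
      using K subspace_scale by blast
    moreover have "c \<odot>\<^bsub>M\<^esub> a = q (scale c v)"
      using calculation K by (subst q_scale) auto
    ultimately show "c \<odot>\<^bsub>M\<^esub> a \<in> H"
      using K by blast
  qed
qed

lemma lin_span_image:
  assumes "S \<subseteq> P"
  shows "lin_span M (q ` S) = q ` span S"
proof
  have "span S \<subseteq> P"
    using assms span_minimal subspace_P by blast
  hence "subspace_of (q ` span S) M"
    unfolding subspace_of_iff using subspace_span by blast
  thus "lin_span M (q ` S) \<subseteq> q ` span S"
    unfolding lin_span_def using span_superset by blast
  show "q ` span S \<subseteq> lin_span M (q ` S)"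
    unfolding lin_span_def
  proof (rule Inter_greatest)
    fix H assume "H \<in> {H. subspace_of H M \<and> q ` S \<subseteq> H}"
    then obtain K where K: "subspace K" "K \<subseteq> P" "H = q ` K" "q ` S \<subseteq> q ` K"
      unfolding subspace_of_iff by blast
    hence "S \<subseteq> K"
      using inj_on_image_mem_iff[OF inj_q] assms by blast
    thus "q ` span S \<subseteq> H"
      using K span_minimal by blast
  qed
qed

lemma lin_indep_image:
  assumes "S \<subseteq> P"
  shows "lin_indep M (q ` S) \<longleftrightarrow> independent S"
proof -
  have "q x \<in> lin_span M (q ` S - {q x}) \<longleftrightarrow> x \<in> span (S - {x})" if "x \<in> S" for x
  proof -
    have "q ` S - {q x} = q ` (S - {x})"
      using inj_on_image_set_diff[OF inj_q, of S "{x}"] assms that by auto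
    hence "lin_span M (q ` S - {q x}) = q ` span (S - {x})"
      using assms by (subst lin_span_image[symmetric]) auto
    moreover have "span (S - {x}) \<subseteq> P"
      using assms subspace_P by (intro span_minimal) auto
    ultimately show ?thesis
      using inj_on_image_mem_iff[OF inj_q, of x "span (S - {x})"] assms that
      by (simp add: subset_iff)
  qed
  thus ?thesis
    using assms by (auto simp: lin_indep_def dependent_def carrier_eq)
qed

lemma is_basis_image:
  assumes "S \<subseteq> P"
  shows "is_basis M (q ` S) \<longleftrightarrow> independent S \<and> span S = P"
proof -
  have "span S \<subseteq> P"
    using assms span_minimal subspace_P by blast
  thus ?thesis
    using inj_on_image_eq_iff[OF inj_q, of "span S" P]
    by (simp add: is_basis_def lin_indep_image lin_span_image assms carrier_eq)
qed

text \<open>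
  Every basis of \<open>M\<close> is the image of a basis of \<open>P\<close>, and these all have the same
  cardinality; hence the arbitrary basis in the definition of the dimension is harmless.
\<close>

lemma dimension_of_eq_dim: "dimension_of M = dim P"
proof -
  obtain B where "B \<subseteq> P" "independent B" "P \<subseteq> span B"
    using maximal_independent_subset[of P] .
  moreover from this have "span B = P"
    using span_minimal[OF _ subspace_P] by (simp add: antisym)
  ultimately have "is_basis M (q ` B)"
    by (simp add: is_basis_image)
  hence "\<exists>T. is_basis M T" ..
  hence T: "is_basis M (SOME T. is_basis M T)" (is "is_basis M ?T")
    by (rule someI_ex)
  hence "?T \<subseteq> q ` P"
    by (simp add: is_basis_def lin_indep_def carrier_eq)
  then obtain S where S: "S \<subseteq> P" "?T = q ` S"
    by (meson subset_imageE)
  have "independent S" "span S = P"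
    using T is_basis_image[OF S(1)] by (simp_all add: S(2))
  have "span S = span P"
    using \<open>span S = P\<close> span_eq_iff[THEN iffD2, OF subspace_P] by (rule trans[OF _ sym])
  hence "dim P = card S"
    using \<open>independent S\<close> by (rule dim_eq_card)
  moreover have "card ?T = card S"
    unfolding S(2) using S(1) inj_q by (intro card_image) (auto intro: inj_on_subset)
  ultimately show ?thesis
    by (simp add: dimension_of_def)
qed

end

text \<open>
  The cosets of the elements of a complement \<open>C\<close> of \<open>W\<close> are pairwise distinct and exhaust the
  quotient. So \<open>C\<close> coordinatizes the quotient, and its dimension is computed inside the ambient
  space.
\<close>

lemma (in vector_space) dimension_of_quotient_space:
  fixes M :: "('a, 'b) module"
  assumes carrier_M: "carrier M = P" and add_M: "add M = (+)" and smult_M: "module.smult M = scale"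
    and P: "subspace P" and W: "subspace W" "W \<subseteq> P"
    and S: "P \<subseteq> span S" "finite S"
  shows "dimension_of (quotient_space M W) = dim P - dim W"
proof -
  obtain C where C: "subspace C" "C \<subseteq> P" "W \<inter> C = {0}" "P = {w + c | w c. w \<in> W \<and> c \<in> C}"
    using complement_exists[OF W(1) P W(2)] .
  define q where "q x = {z. z - x \<in> W}" for x
  have coset: "W +>\<^bsub>M\<^esub> x = q x" for x
    by (force simp: a_r_coset_def' add_M q_def)
  have q_eq: "q x = q y" if "x - y \<in> W" for x y
  proof -
    have "z - x \<in> W \<longleftrightarrow> z - y \<in> W" for z
      using subspace_add[OF W(1), of "z - x" "x - y"] subspace_diff[OF W(1), of "z - y" "x - y"] that
      by auto
    thus ?thesis
      by (simp add: q_def)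
  qed
  have surj: "q ` C = q ` P"
  proof
    show "q ` C \<subseteq> q ` P"
      using C(2) by (rule image_mono)
    show "q ` P \<subseteq> q ` C"
    proof
      fix z assume "z \<in> q ` P"
      then obtain x w c where "z = q x" "w \<in> W" "c \<in> C" "x = w + c"
        using C(4) by blast
      moreover from this have "q x = q c"
        by (intro q_eq) simp
      ultimately show "z \<in> q ` C"
        by blast
    qed
  qed
  interpret quot: linear_coordinates scale "quotient_space M W" C q
  proof unfold_locales
    show "subspace C" by (fact C(1))
    have "inj_on q C"
    proof (rule inj_onI)
      fix x y assume xy: "x \<in> C" "y \<in> C" "q x = q y"
      have "x \<in> q x"
        using subspace_0[OF W(1)] by (simp add: q_def)
      hence "x \<in> q y"
        by (simp only: xy(3))
      hence "x - y \<in> W"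
        by (simp add: q_def)
      moreover have "x - y \<in> C"
        using xy C(1) subspace_diff by blast
      ultimately have "x - y = 0"
        using C(3) by blast
      thus "x = y" by simp
    qed
    moreover have "carrier (quotient_space M W) = q ` P"
      by (auto simp: quotient_space_def A_RCOSETS_def' coset carrier_M)
    ultimately show "bij_betw q C (carrier (quotient_space M W))"
      by (simp add: bij_betw_def surj)
    show "q 0 = \<zero>\<^bsub>quotient_space M W\<^esub>"
      by (simp add: quotient_space_def q_def)
  next
    fix x y
    have "z \<in> q (x + y) \<longleftrightarrow> (\<exists>h\<in>q x. \<exists>k\<in>q y. z = h + k)" for z
    proof
      assume "z \<in> q (x + y)"
      hence "z - y \<in> q x" "y \<in> q y"
        using subspace_0[OF W(1)] by (simp_all add: q_def algebra_simps)
      thus "\<exists>h\<in>q x. \<exists>k\<in>q y. z = h + k"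
        by (metis diff_add_cancel)
    next
      assume "\<exists>h\<in>q x. \<exists>k\<in>q y. z = h + k"
      then obtain h k where "h - x \<in> W" "k - y \<in> W" "z = h + k"
        by (auto simp: q_def)
      thus "z \<in> q (x + y)"
        using subspace_add[OF W(1), of "h - x" "k - y"] by (simp add: q_def algebra_simps)
    qed
    thus "q (x + y) = q x \<oplus>\<^bsub>quotient_space M W\<^esub> q y"
      by (auto simp: quotient_space_def set_add_def' add_M)
  next
    fix c x
    have "z \<in> q (scale c x) \<longleftrightarrow> (\<exists>u\<in>q x. z \<in> q (scale c u))" for z
    proof
      assume "z \<in> q (scale c x)"
      moreover have "x \<in> q x"
        using subspace_0[OF W(1)] by (simp add: q_def)
      ultimately show "\<exists>u\<in>q x. z \<in> q (scale c u)" by blast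
    next
      assume "\<exists>u\<in>q x. z \<in> q (scale c u)"
      then obtain u where "u - x \<in> W" "z - scale c u \<in> W"
        by (auto simp: q_def)
      thus "z \<in> q (scale c x)"
        using subspace_add[OF W(1), of "z - scale c u" "scale c (u - x)"] subspace_scale[OF W(1), of "u - x" c]
        by (simp add: q_def scale_right_diff_distrib)
    qed
    thus "q (scale c x) = c \<odot>\<^bsub>quotient_space M W\<^esub> q x"
      by (auto simp: quotient_space_def smult_M coset)
  qed
  show ?thesis
    using quot.dimension_of_eq_dim dim_complement[OF W(1) C(1,3,4) S] by simp
qed

section \<open>Codimensions as differences of dimensions\<close>

text \<open>
  All functions from words to scalars form a vector space under the pointwise operations, and the
  free algebra is the subspace of finitely supported functions that vanish at the empty word.
\<close>

interpretation poly_space: vector_space "\<lambda>c f w. c * f w :: 'k::field"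
  by unfold_locales (auto simp: fun_eq_iff algebra_simps)

lemma subspace_free_algebra: "poly_space.subspace (carrier free_algebra)"
proof (rule poly_space.subspaceI)
  fix f g :: "nat list \<Rightarrow> 'k::field" and c :: 'k
  assume f: "f \<in> carrier free_algebra"
  show "(\<lambda>w. c * f w) \<in> carrier free_algebra"
    using f finite_subset[of "{w. c * f w \<noteq> 0}" "{w. f w \<noteq> 0}"] by (auto simp: free_algebra_def)
  assume g: "g \<in> carrier free_algebra"
  have "finite {w. f w + g w \<noteq> 0}"
    by (rule finite_subset[of _ "{w. f w \<noteq> 0} \<union> {w. g w \<noteq> 0}"]) (use f g in \<open>auto simp: free_algebra_def\<close>)
  with f g show "f + g \<in> carrier free_algebra"
    by (auto simp: free_algebra_def)
qed (simp add: free_algebra_def)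

interpretation free_algebra: linear_coordinates
  "\<lambda>c f w. c * f w :: 'k::field" free_algebra "carrier free_algebra" "\<lambda>f. f"
proof unfold_locales
  show "poly_space.subspace (carrier (free_algebra :: ('k, nat list \<Rightarrow> 'k) module))"
    by (rule subspace_free_algebra)
qed (auto simp: free_algebra_def fun_eq_iff bij_betw_def)

definition multilinear_monomials :: "nat \<Rightarrow> (nat list \<Rightarrow> 'k::field) set"
  where "multilinear_monomials n = {monomial_of (map \<sigma> [1..<Suc n]) | \<sigma>. \<sigma> permutes {1..n}}"

lemma finite_multilinear_monomials: "finite (multilinear_monomials n)"
proof -
  have eq: "multilinear_monomials n =
      (\<lambda>\<sigma>. monomial_of (map \<sigma> [1..<Suc n])) ` {\<sigma>. \<sigma> permutes {1..n}}"
    by (auto simp: multilinear_monomials_def)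
  show ?thesis
    unfolding eq by (intro finite_imageI finite_permutations finite_atLeastAtMost)
qed

text \<open>
  For \<open>n = 0\<close> the only generator is the monomial of the empty word, which lies outside the free
  algebra, so that no subspace contains it and its span degenerates to the whole type.
\<close>

lemma multilinear_space_eq_span:
  assumes "0 < n"
  shows "multilinear_space n = poly_space.span (multilinear_monomials n)"
proof -
  have "multilinear_monomials n \<subseteq> carrier free_algebra"
    using assms by (auto simp: multilinear_monomials_def monomial_of_def free_algebra_def)
  from free_algebra.lin_span_image[OF this] show ?thesis
    by (simp add: multilinear_space_def multilinear_monomials_def)
qed

lemma codim_eq_dim_diff:
  fixes A :: "('k::field, 'a) module"
  assumes "0 < n" and "poly_space.subspace (identities A)"
  shows "codim A n = poly_space.dim (multilinear_space n :: (nat list \<Rightarrow> 'k) set)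
    - poly_space.dim (multilinear_space n \<inter> identities A)"
  unfolding codim_def
proof (rule poly_space.dimension_of_quotient_space)
  show "poly_space.subspace (multilinear_space n :: (nat list \<Rightarrow> 'k) set)"
    using assms(1) by (simp add: multilinear_space_eq_span poly_space.subspace_span)
  with assms(2) show "poly_space.subspace (multilinear_space n \<inter> identities A)"
    by (simp add: poly_space.subspace_inter)
qed (auto simp: multilinear_space_eq_span[OF assms(1)] finite_multilinear_monomials free_algebra_def fun_eq_iff)

section \<open>The subspace of identities\<close>

context assoc_algebra
begin

lemma word_value_closed: "a \<in> UNIV \<rightarrow> carrier A \<Longrightarrow> word_value A a w \<in> carrier A"
  by (induction w rule: induct_list012) (auto intro: mult_closed)

lemma scalar_closed: "x \<in> carrier A \<Longrightarrow> c \<odot> x \<in> carrier A"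
  by (intro smult_closed) (simp_all add: ring_of_type_algebra_def)

text \<open>
  Polynomials with different supports can be added or compared only when their values are sums
  over a common set of words.
\<close>

lemma poly_value_superset:
  assumes a: "a \<in> UNIV \<rightarrow> carrier A" and "finite S" "{w. f w \<noteq> 0} \<subseteq> S"
  shows "poly_value A a f = (\<Oplus>w\<in>S. f w \<odot> word_value A a w)"
  unfolding poly_value_def
proof (rule add.finprod_mono_neutral_cong_left)
  fix w assume "w \<in> S - {w. f w \<noteq> 0}"
  thus "f w \<odot> word_value A a w = \<zero>"
    using smult_l_null[OF word_value_closed[OF a]] by (simp add: ring_of_type_algebra_def)
qed (use assms in \<open>auto intro!: scalar_closed word_value_closed\<close>)

lemma poly_value_add:
  assumes a: "a \<in> UNIV \<rightarrow> carrier A" and "f \<in> carrier free_algebra" "g \<in> carrier free_algebra"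
  shows "poly_value A a (f + g) = poly_value A a f \<oplus> poly_value A a g"
proof -
  let ?S = "{w. f w \<noteq> 0} \<union> {w. g w \<noteq> 0}"
  have S: "finite ?S"
    using assms by (simp add: free_algebra_def)
  have "poly_value A a (f + g) = (\<Oplus>w\<in>?S. (f + g) w \<odot> word_value A a w)"
    by (rule poly_value_superset[OF a S]) auto
  also have "\<dots> = (\<Oplus>w\<in>?S. f w \<odot> word_value A a w \<oplus> g w \<odot> word_value A a w)"
    using smult_l_distr[OF _ _ word_value_closed[OF a]]
    by (intro finsum_cong') (auto simp: ring_of_type_algebra_def intro!: scalar_closed word_value_closed a)
  also have "\<dots> = (\<Oplus>w\<in>?S. f w \<odot> word_value A a w) \<oplus> (\<Oplus>w\<in>?S. g w \<odot> word_value A a w)"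
    using a by (intro finsum_addf) (auto intro!: scalar_closed word_value_closed)
  also have "\<dots> = poly_value A a f \<oplus> poly_value A a g"
    using poly_value_superset[OF a S] by simp
  finally show ?thesis .
qed

lemma poly_value_smult:
  assumes a: "a \<in> UNIV \<rightarrow> carrier A" and "f \<in> carrier free_algebra"
  shows "poly_value A a (\<lambda>w. c * f w) = c \<odot> poly_value A a f"
proof -
  let ?S = "{w. f w \<noteq> 0}"
  have S: "finite ?S"
    using assms by (simp add: free_algebra_def)
  have "poly_value A a (\<lambda>w. c * f w) = (\<Oplus>w\<in>?S. (c * f w) \<odot> word_value A a w)"
    by (rule poly_value_superset[OF a S]) auto
  also have "\<dots> = (\<Oplus>w\<in>?S. c \<odot> (f w \<odot> word_value A a w))"
    using smult_assoc1[OF _ _ word_value_closed[OF a]]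
    by (intro finsum_cong') (auto simp: ring_of_type_algebra_def intro!: scalar_closed word_value_closed a)
  also have "\<dots> = c \<odot> poly_value A a f"
    unfolding poly_value_def using S a
    by (intro finsum_smult_ldistr[symmetric])
      (auto simp: ring_of_type_algebra_def intro!: scalar_closed word_value_closed)
  finally show ?thesis .
qed

lemma subspace_identities: "poly_space.subspace (identities A)"
proof (rule poly_space.subspaceI)
  show "0 \<in> identities A"
    using poly_space.subspace_0[OF subspace_free_algebra]
    by (simp add: identities_def poly_value_def)
next
  fix f g assume "f \<in> identities A" "g \<in> identities A"
  thus "f + g \<in> identities A"
    using poly_space.subspace_add[OF subspace_free_algebra, of f g]
    by (auto simp: identities_def poly_value_add)
next
  fix c f assume "f \<in> identities A"
  thus "(\<lambda>w. c * f w) \<in> identities A"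
    using poly_space.subspace_scale[OF subspace_free_algebra, of f c] smult_r_null
    by (auto simp: identities_def poly_value_smult ring_of_type_algebra_def)
qed

end

section \<open>Identities and codimensions of a product\<close>

lemma prod_algebra_carrier_iff:
  "x \<in> carrier (prod_algebra I B) \<longleftrightarrow> x \<in> extensional I \<and> (\<forall>i\<in>I. x i \<in> carrier (B i))"
  by (auto simp: prod_algebra_def PiE_iff)

lemma prod_algebra_component [simp]:
  assumes "i \<in> I"
  shows "\<zero>\<^bsub>prod_algebra I B\<^esub> i = \<zero>\<^bsub>B i\<^esub>"
    and "(x \<oplus>\<^bsub>prod_algebra I B\<^esub> y) i = x i \<oplus>\<^bsub>B i\<^esub> y i"
    and "(x \<otimes>\<^bsub>prod_algebra I B\<^esub> y) i = x i \<otimes>\<^bsub>B i\<^esub> y i"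
    and "(c \<odot>\<^bsub>prod_algebra I B\<^esub> x) i = c \<odot>\<^bsub>B i\<^esub> x i"
  using assms by (simp_all add: prod_algebra_def)

lemma prod_algebra_extensional [simp]:
  "\<zero>\<^bsub>prod_algebra I B\<^esub> \<in> extensional I"
  "x \<oplus>\<^bsub>prod_algebra I B\<^esub> y \<in> extensional I"
  "x \<otimes>\<^bsub>prod_algebra I B\<^esub> y \<in> extensional I"
  "c \<odot>\<^bsub>prod_algebra I B\<^esub> x \<in> extensional I"
  by (simp_all add: prod_algebra_def)

context
  fixes I :: "'i set" and B :: "'i \<Rightarrow> ('k::field, 'b) module"
  assumes B: "\<And>i. i \<in> I \<Longrightarrow> assoc_algebra (B i)"
begin

lemma abelian_monoid_prod_algebra: "abelian_monoid (prod_algebra I B)"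
proof -
  have M: "abelian_monoid (B i)" if "i \<in> I" for i
  proof -
    interpret assoc_algebra "B i" using B[OF that] .
    show ?thesis ..
  qed
  note E = abelian_monoidE[OF M]
  show ?thesis
    by (rule abelian_monoidI)
      (auto simp: prod_algebra_carrier_iff E(1,2,4) intro!: E(3,5) extensionalityI[where A = I])
qed

lemma word_value_prod_algebra:
  assumes "i \<in> I"
  shows "word_value (prod_algebra I B) a w i = word_value (B i) (\<lambda>n. a n i) w"
  using assms by (induction w rule: induct_list012) simp_all

lemma finsum_prod_algebra:
  assumes i: "i \<in> I" and "finite S" "g \<in> S \<rightarrow> carrier (prod_algebra I B)"
  shows "(\<Oplus>\<^bsub>prod_algebra I B\<^esub>w\<in>S. g w) i = (\<Oplus>\<^bsub>B i\<^esub>w\<in>S. g w i)"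
proof -
  interpret P: abelian_monoid "prod_algebra I B"
    by (rule abelian_monoid_prod_algebra)
  interpret Bi: assoc_algebra "B i"
    using B[OF i] .
  have comp: "x i \<in> carrier (B i)" if "x \<in> carrier (prod_algebra I B)" for x
    using that i by (simp add: prod_algebra_carrier_iff)
  show ?thesis
    using assms(2,3)
  proof (induction S rule: finite_induct)
    case empty
    then show ?case using i by simp
  next
    case (insert x S)
    have "(\<Oplus>\<^bsub>prod_algebra I B\<^esub>w\<in>insert x S. g w) i
        = (g x \<oplus>\<^bsub>prod_algebra I B\<^esub> (\<Oplus>\<^bsub>prod_algebra I B\<^esub>w\<in>S. g w)) i"
      using insert by (subst P.finsum_insert) auto
    also have "\<dots> = g x i \<oplus>\<^bsub>B i\<^esub> (\<Oplus>\<^bsub>prod_algebra I B\<^esub>w\<in>S. g w) i"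
      using i by simp
    also have "\<dots> = (\<Oplus>\<^bsub>B i\<^esub>w\<in>insert x S. g w i)"
      using insert by (subst Bi.finsum_insert) (auto intro!: comp)
    finally show ?case .
  qed
qed

lemma word_value_prod_algebra_closed:
  assumes "a \<in> UNIV \<rightarrow> carrier (prod_algebra I B)"
  shows "word_value (prod_algebra I B) a w \<in> carrier (prod_algebra I B)"
proof (induction w rule: induct_list012)
  case 1
  show ?case
    using abelian_monoid.zero_closed[OF abelian_monoid_prod_algebra] by simp
next
  case (2 x)
  show ?case using assms by auto
next
  case (3 x y zs)
  have "a x \<in> carrier (prod_algebra I B)"
    using assms by auto
  with 3 show ?case
    by (auto simp: prod_algebra_carrier_iff intro!: assoc_algebra.mult_closed[OF B])
qed

lemma scalar_closed_prod_algebra: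
  "x \<in> carrier (prod_algebra I B) \<Longrightarrow>
    c \<odot>\<^bsub>prod_algebra I B\<^esub> x \<in> carrier (prod_algebra I B)"
  by (auto simp: prod_algebra_carrier_iff intro!: assoc_algebra.scalar_closed[OF B])

lemma poly_value_prod_algebra:
  assumes i: "i \<in> I" and a: "a \<in> UNIV \<rightarrow> carrier (prod_algebra I B)"
    and f: "f \<in> carrier free_algebra"
  shows "poly_value (prod_algebra I B) a f i = poly_value (B i) (\<lambda>n. a n i) f"
proof -
  interpret Bi: assoc_algebra "B i"
    using B[OF i] .
  have S: "finite {w. f w \<noteq> 0}"
    using f by (simp add: free_algebra_def)
  have ai: "(\<lambda>n. a n i) \<in> UNIV \<rightarrow> carrier (B i)"
    using a i by (auto simp: prod_algebra_carrier_iff Pi_iff)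
  have "poly_value (prod_algebra I B) a f i
      = (\<Oplus>\<^bsub>B i\<^esub>w\<in>{w. f w \<noteq> 0}. (f w \<odot>\<^bsub>prod_algebra I B\<^esub> word_value (prod_algebra I B) a w) i)"
    unfolding poly_value_def
    by (intro finsum_prod_algebra[OF i S]) (auto intro: scalar_closed_prod_algebra word_value_prod_algebra_closed[OF a])
  also have "\<dots> = poly_value (B i) (\<lambda>n. a n i) f"
    unfolding poly_value_def
  proof (rule Bi.finsum_cong')
    fix w
    show "(f w \<odot>\<^bsub>prod_algebra I B\<^esub> word_value (prod_algebra I B) a w) i
        = f w \<odot>\<^bsub>B i\<^esub> word_value (B i) (\<lambda>n. a n i) w"
      using i by (simp add: word_value_prod_algebra)
  qed (auto intro!: Bi.scalar_closed Bi.word_value_closed ai)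
  finally show ?thesis .
qed

lemma poly_value_prod_algebra_closed:
  assumes "a \<in> UNIV \<rightarrow> carrier (prod_algebra I B)"
  shows "poly_value (prod_algebra I B) a f \<in> carrier (prod_algebra I B)"
proof -
  interpret P: abelian_monoid "prod_algebra I B"
    by (rule abelian_monoid_prod_algebra)
  show ?thesis
    unfolding poly_value_def
    by (intro P.finsum_closed) (auto intro: scalar_closed_prod_algebra word_value_prod_algebra_closed[OF assms])
qed

text \<open>
  Evaluation in the product is evaluation in each factor. Conversely, an evaluation in one factor
  extends to the product by zero in the other factors.
\<close>

lemma identities_prod_algebra:
  "identities (prod_algebra I B) = carrier free_algebra \<inter> (\<Inter>i\<in>I. identities (B i))"
proof (intro equalityI subsetI)
  fix f :: "nat list \<Rightarrow> 'k" assume f: "f \<in> identities (prod_algebra I B)"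
  hence f0: "f \<in> carrier free_algebra"
    by (simp add: identities_def)
  have "poly_value (B i) b f = \<zero>\<^bsub>B i\<^esub>" if i: "i \<in> I" and b: "b \<in> UNIV \<rightarrow> carrier (B i)" for i b
  proof -
    \<comment> \<open>the evaluation \<open>b\<close> in the \<open>i\<close>-th factor, and zero in all others\<close>
    define a where "a n = (\<lambda>j\<in>I. if j = i then b n else \<zero>\<^bsub>B j\<^esub>)" for n
    have "\<zero>\<^bsub>B j\<^esub> \<in> carrier (B j)" if "j \<in> I" for j
    proof -
      interpret assoc_algebra "B j" using B[OF that] .
      show ?thesis by (rule zero_closed)
    qed
    hence a: "a \<in> UNIV \<rightarrow> carrier (prod_algebra I B)"
      using b by (auto simp: a_def prod_algebra_carrier_iff Pi_iff)
    have "poly_value (B i) b f = poly_value (prod_algebra I B) a f i"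
      using i by (simp add: poly_value_prod_algebra[OF i a f0] a_def)
    also have "\<dots> = \<zero>\<^bsub>B i\<^esub>"
      using f a i by (simp add: identities_def)
    finally show ?thesis .
  qed
  with f0 show "f \<in> carrier free_algebra \<inter> (\<Inter>i\<in>I. identities (B i))"
    by (auto simp: identities_def)
next
  fix f :: "nat list \<Rightarrow> 'k" assume f: "f \<in> carrier free_algebra \<inter> (\<Inter>i\<in>I. identities (B i))"
  have "poly_value (prod_algebra I B) a f = \<zero>\<^bsub>prod_algebra I B\<^esub>"
    if a: "a \<in> UNIV \<rightarrow> carrier (prod_algebra I B)" for a
  proof (rule extensionalityI[where A = I])
    show "poly_value (prod_algebra I B) a f \<in> extensional I"
      using poly_value_prod_algebra_closed[OF a, of f] by (simp add: prod_algebra_carrier_iff)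
    show "\<zero>\<^bsub>prod_algebra I B\<^esub> \<in> extensional I"
      by simp
    fix i assume i: "i \<in> I"
    have "(\<lambda>n. a n i) \<in> UNIV \<rightarrow> carrier (B i)"
      using a i by (auto simp: prod_algebra_carrier_iff Pi_iff)
    hence "poly_value (prod_algebra I B) a f i = \<zero>\<^bsub>B i\<^esub>"
      using f i poly_value_prod_algebra[OF i a] by (simp add: identities_def)
    thus "poly_value (prod_algebra I B) a f i = \<zero>\<^bsub>prod_algebra I B\<^esub> i"
      using i by simp
  qed
  with f show "f \<in> identities (prod_algebra I B)"
    by (simp add: identities_def)
qed

end

text \<open>
  With \<open>P\<close> the multilinear polynomials of degree \<open>n\<close>, the space \<open>P / (P \<inter> Id A)\<close> maps onto each
  \<open>P / (P \<inter> Id (B i))\<close> and embeds into their product, since \<open>Id A\<close> is the intersection of the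
  \<open>Id (B i)\<close>.
\<close>

lemma codim_bounds:
  fixes A :: "('k::field, 'a) module" and B :: "'i \<Rightarrow> ('k, 'b) module"
  assumes "finite I" "I \<noteq> {}" and B: "\<And>i. i \<in> I \<Longrightarrow> assoc_algebra (B i)"
    and A: "pi_equivalent A (prod_algebra I B)" and n: "0 < n"
  shows codim_le_sum: "codim A n \<le> (\<Sum>i\<in>I. codim (B i) n)"
    and codim_ge: "i \<in> I \<Longrightarrow> codim (B i) n \<le> codim A n"
proof -
  let ?P = "multilinear_space n :: (nat list \<Rightarrow> 'k) set"
  have sub: "poly_space.subspace (identities (B i))" if "i \<in> I" for i
    using assoc_algebra.subspace_identities[OF B[OF that]] .
  have A_eq: "identities A = (\<Inter>i\<in>I. identities (B i))"
    using A identities_prod_algebra[of I B, OF B] assms(2)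
    by (auto simp: pi_equivalent_def identities_def)
  hence subA: "poly_space.subspace (identities A)"
    using sub by (simp add: poly_space.subspace_Int)
  have P: "poly_space.subspace ?P" "?P \<subseteq> poly_space.span (multilinear_monomials n)"
    using n by (simp_all add: multilinear_space_eq_span poly_space.subspace_span)
  note codim_eq = codim_eq_dim_diff[OF n]
  show "codim A n \<le> (\<Sum>i\<in>I. codim (B i) n)"
    using poly_space.dim_diff_INT_le[where W = "\<lambda>i. identities (B i)",
        OF assms(1) sub P finite_multilinear_monomials]
    by (simp add: codim_eq subA sub A_eq[symmetric])
  assume i: "i \<in> I"
  have "poly_space.dim (?P \<inter> identities A) \<le> poly_space.dim (?P \<inter> identities (B i))"
    using i P A_eq sub[OF i] subA
    by (intro poly_space.dim_subspace_mono[of _ _ "multilinear_monomials n"]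
        poly_space.subspace_inter finite_multilinear_monomials) auto
  thus "codim (B i) n \<le> codim A n"
    by (simp add: codim_eq subA sub[OF i])
qed

section \<open>Sequences squeezed between finitely many sequences and their sum\<close>

lemma tendsto_Max:
  fixes f :: "'i \<Rightarrow> 'x \<Rightarrow> 'y::linorder_topology"
  assumes "finite I" "I \<noteq> {}" "\<And>i. i \<in> I \<Longrightarrow> (f i \<longlongrightarrow> L i) F"
  shows "((\<lambda>x. Max ((\<lambda>i. f i x) ` I)) \<longlongrightarrow> Max (L ` I)) F"
  using assms by (induction I rule: finite_ne_induct) (auto intro!: tendsto_max)

text \<open>
  The sequence \<open>a\<close> lies between the largest of the \<open>b i\<close> and \<open>card I\<close> times it, and the root
  of the constant \<open>card I\<close> tends to \<open>1\<close>.
\<close>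

lemma root_tendsto_Max:
  fixes a :: "nat \<Rightarrow> real" and b :: "'i \<Rightarrow> nat \<Rightarrow> real"
  assumes I: "finite I" "I \<noteq> {}"
    and lim: "\<And>i. i \<in> I \<Longrightarrow> (\<lambda>n. root n (b i n)) \<longlonglongrightarrow> L i"
    and lower: "\<And>i. i \<in> I \<Longrightarrow> \<forall>\<^sub>F n in sequentially. b i n \<le> a n"
    and upper: "\<forall>\<^sub>F n in sequentially. a n \<le> (\<Sum>i\<in>I. b i n)"
  shows "(\<lambda>n. root n (a n)) \<longlonglongrightarrow> Max (L ` I)"
proof (rule tendsto_sandwich)
  let ?m = "\<lambda>n. Max ((\<lambda>i. root n (b i n)) ` I)"
  show "?m \<longlonglongrightarrow> Max (L ` I)"
    using tendsto_Max[OF I lim] .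
  moreover have "(\<lambda>n. root n (card I)) \<longlonglongrightarrow> 1"
    using LIMSEQ_root_const[of "card I"] I by (simp add: card_gt_0_iff)
  ultimately show "(\<lambda>n. root n (card I) * ?m n) \<longlonglongrightarrow> Max (L ` I)"
    using tendsto_mult by fastforce
  have "\<forall>\<^sub>F n in sequentially. \<forall>i\<in>I. b i n \<le> a n"
    using I lower by (simp add: eventually_ball_finite)
  thus "\<forall>\<^sub>F n in sequentially. ?m n \<le> root n (a n)"
    using eventually_gt_at_top[of 0] by eventually_elim (use I in \<open>auto simp: Max_le_iff\<close>)
  show "\<forall>\<^sub>F n in sequentially. root n (a n) \<le> root n (card I) * ?m n"
    using upper eventually_gt_at_top[of 0]
  proof eventually_elim
    case (elim n)
    have "Max ((\<lambda>i. b i n) ` I) \<in> (\<lambda>i. b i n) ` I"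
      using I by (intro Max_in) auto
    then obtain j where j: "j \<in> I" "Max ((\<lambda>i. b i n) ` I) = b j n"
      by auto
    have "b i n \<le> b j n" if "i \<in> I" for i
      unfolding j(2)[symmetric] using that I by (intro Max_ge) auto
    hence "(\<Sum>i\<in>I. b i n) \<le> card I * b j n"
      by (rule sum_bounded_above)
    with elim have "root n (a n) \<le> root n (card I * b j n)"
      by simp
    also have "\<dots> = root n (card I) * root n (b j n)"
      by (rule real_root_mult)
    also have "\<dots> \<le> root n (card I) * ?m n"
      using I j elim by (intro mult_left_mono Max_ge) auto
    finally show ?case .
  qed
qed

text \<open>
  The sequence \<open>a\<close> is of exact order \<open>n powr t * d ^ n\<close>. The two bounds are stated separately
  since most arguments use only one of them.
\<close>

definition poly_growth :: "(nat \<Rightarrow> real) \<Rightarrow> real \<Rightarrow> real \<Rightarrow> bool"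
  where "poly_growth a d t \<longleftrightarrow>
    (\<exists>c>0. \<forall>\<^sub>F n in sequentially. c * real n powr t * d ^ n \<le> a n) \<and>
    (\<exists>c>0. \<forall>\<^sub>F n in sequentially. a n \<le> c * real n powr t * d ^ n)"

text \<open>
  The lower bound for \<open>s\<close> divided by the upper bound for \<open>t\<close> shows that \<open>n powr (s - t)\<close> remains
  bounded, which fails for \<open>s > t\<close>.
\<close>

lemma poly_growth_le:
  assumes "poly_growth a d s" "poly_growth a d t" "0 < d"
  shows "s \<le> t"
proof (rule ccontr)
  assume "\<not> s \<le> t"
  obtain c where c: "0 < c" "\<forall>\<^sub>F n in sequentially. c * real n powr s * d ^ n \<le> a n"
    using assms(1) unfolding poly_growth_def by blast
  obtain C where C: "0 < C" "\<forall>\<^sub>F n in sequentially. a n \<le> C * real n powr t * d ^ n"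
    using assms(2) unfolding poly_growth_def by blast
  have "\<forall>\<^sub>F n in sequentially. real n powr (s - t) \<le> C / c"
    using c(2) C(2) eventually_gt_at_top[of 0]
  proof eventually_elim
    case (elim n)
    hence "c * real n powr s \<le> C * real n powr t"
      using assms(3) by (meson order_trans mult_le_cancel_right_pos zero_less_power)
    thus ?case
      using c(1) elim(3) by (simp add: powr_diff field_simps)
  qed
  moreover have "filterlim (\<lambda>n::nat. real n powr (s - t)) at_top sequentially"
    using \<open>\<not> s \<le> t\<close> by real_asymp
  hence "\<forall>\<^sub>F n in sequentially. C / c < real n powr (s - t)"
    by (simp add: filterlim_at_top_dense)
  ultimately have "\<forall>\<^sub>F n::nat in sequentially. False"
    by eventually_elim simp
  thus False by simp
qed

lemma poly_growth_unique:
  assumes "poly_growth a d s" "poly_growth a d t" "0 < d"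
  shows "s = t"
  using poly_growth_le assms by (intro antisym)

text \<open>
  An exponentially smaller sequence is dominated whatever its polynomial factor is; for equal
  exponential rates the polynomial factors decide.
\<close>

lemma poly_growth_bound:
  assumes a: "poly_growth a e s" and "0 \<le> e" "0 < d" "e < d \<or> e = d \<and> s \<le> t"
  shows "\<exists>C>0. \<forall>\<^sub>F n in sequentially. a n \<le> C * real n powr t * d ^ n"
proof -
  obtain C where C: "0 < C" "\<forall>\<^sub>F n in sequentially. a n \<le> C * real n powr s * e ^ n"
    using a unfolding poly_growth_def by blast
  have "\<forall>\<^sub>F n in sequentially. real n powr s * e ^ n \<le> real n powr t * d ^ n"
  proof (cases "e = d")
    case True
    hence "s \<le> t" using assms by simp
    show ?thesis
      using eventually_gt_at_top[of 0]
      by eventually_elim (use True \<open>s \<le> t\<close> \<open>0 < d\<close> in \<open>auto intro!: powr_mono\<close>)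
  next
    case False
    hence "e < d" using assms by simp
    show ?thesis
    \<comment> \<open>the limit of \<open>n powr u * r ^ n\<close> is computed through \<open>ln r\<close>, hence for positive \<open>r\<close> only\<close>
    proof (cases "e = 0")
      case True
      show ?thesis
        using eventually_gt_at_top[of 0]
        by eventually_elim (use True \<open>0 < d\<close> in \<open>simp add: zero_power\<close>)
    next
      case False
      hence "0 < e" using assms by simp
      have "(\<lambda>n. real n powr (s - t) * r ^ n) \<longlonglongrightarrow> 0" if "0 < r" "r < 1" for r :: real
        using that by real_asymp
      hence "(\<lambda>n. real n powr (s - t) * (e / d) ^ n) \<longlonglongrightarrow> 0"
        using \<open>0 < e\<close> \<open>0 < d\<close> \<open>e < d\<close> by simp
      hence "\<forall>\<^sub>F n in sequentially. real n powr (s - t) * (e / d) ^ n < 1"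
        by (rule order_tendstoD) simp
      thus ?thesis
        using eventually_gt_at_top[of 0]
        by eventually_elim (use \<open>0 < d\<close> in \<open>simp add: powr_diff power_divide field_simps\<close>)
    qed
  qed
  with C(2) have "\<forall>\<^sub>F n in sequentially. a n \<le> C * real n powr t * d ^ n"
  proof eventually_elim
    case (elim n)
    note elim(1)
    also have "C * real n powr s * e ^ n \<le> C * real n powr t * d ^ n"
      unfolding mult.assoc using elim(2) C(1) by (intro mult_left_mono) auto
    finally show ?case .
  qed
  with C(1) show ?thesis by blast
qed

text \<open>
  A single \<open>b j\<close> of largest exponential rate and, among those, of largest polynomial exponent
  already gives the lower bound, and it dominates each of the finitely many terms of the upper
  bound.
\<close>

lemma poly_growth_Max:
  fixes a :: "nat \<Rightarrow> real" and b :: "'i \<Rightarrow> nat \<Rightarrow> real"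
  assumes I: "finite I"
    and growth: "\<And>i. i \<in> I \<Longrightarrow> poly_growth (b i) (e i) (t i)"
    and e: "\<And>i. i \<in> I \<Longrightarrow> 0 \<le> e i \<and> e i \<le> d" and d: "0 < d" "d \<in> e ` I"
    and lower: "\<And>i. i \<in> I \<Longrightarrow> \<forall>\<^sub>F n in sequentially. b i n \<le> a n"
    and upper: "\<forall>\<^sub>F n in sequentially. a n \<le> (\<Sum>i\<in>I. b i n)"
  shows "poly_growth a d (Max (t ` {i\<in>I. e i = d}))"
proof -
  let ?J = "{i\<in>I. e i = d}"
  define s where "s = Max (t ` ?J)"
  have J: "finite (t ` ?J)" "t ` ?J \<noteq> {}"
    using I d(2) by auto
  obtain j where j: "j \<in> I" "e j = d" "s = t j"
    using Max_in[OF J] unfolding s_def by auto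
  obtain c where c: "0 < c" "\<forall>\<^sub>F n in sequentially. c * real n powr s * d ^ n \<le> b j n"
    using growth[OF j(1)] unfolding poly_growth_def j(2,3) by blast
  have c': "\<forall>\<^sub>F n in sequentially. c * real n powr s * d ^ n \<le> a n"
    using c(2) lower[OF j(1)] by eventually_elim simp
  have "\<exists>C>0. \<forall>\<^sub>F n in sequentially. b i n \<le> C * real n powr s * d ^ n" if i: "i \<in> I" for i
  proof (rule poly_growth_bound[OF growth[OF i]])
    show "e i < d \<or> e i = d \<and> t i \<le> s"
      using e[OF i] i J(1) by (auto simp: s_def)
  qed (use e[OF i] d in auto)
  then obtain C where C: "\<And>i. i \<in> I \<Longrightarrow> 0 < C i"
    "\<And>i. i \<in> I \<Longrightarrow> \<forall>\<^sub>F n in sequentially. b i n \<le> C i * real n powr s * d ^ n"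
    by metis
  have "\<forall>\<^sub>F n in sequentially. \<forall>i\<in>I. b i n \<le> C i * real n powr s * d ^ n"
    using I C(2) by (simp add: eventually_ball_finite)
  with upper have "\<forall>\<^sub>F n in sequentially. a n \<le> (\<Sum>i\<in>I. C i) * real n powr s * d ^ n"
  proof eventually_elim
    case (elim n)
    have "(\<Sum>i\<in>I. b i n) \<le> (\<Sum>i\<in>I. C i * real n powr s * d ^ n)"
      using elim by (intro sum_mono) auto
    thus ?case
      using elim by (simp add: sum_distrib_right)
  qed
  moreover have "0 < (\<Sum>i\<in>I. C i)"
    using I j(1) C(1) by (intro sum_pos) auto
  ultimately show ?thesis
    unfolding poly_growth_def s_def[symmetric] using c(1) c'
    by blast
qed

section \<open>The exponent and the polynomial part\<close>

lemma is_poly_part_iff: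
  "is_poly_part A t \<longleftrightarrow> 2 * t \<in> \<int> \<and> poly_growth (\<lambda>n. real (codim A n)) (pi_exp A) t"
  unfolding is_poly_part_def poly_growth_def eventually_conj_iff by blast

lemma poly_part_eqI:
  assumes "is_poly_part A t" "0 < pi_exp A"
  shows "poly_part A = t"
  unfolding poly_part_def
  using assms by (intro the_equality) (auto simp: is_poly_part_iff intro: poly_growth_unique)

lemma regular_codim_growth_root_tendsto:
  assumes "regular_codim_growth A"
  shows "(\<lambda>n. root n (real (codim A n))) \<longlonglongrightarrow> pi_exp A"
  using assms by (simp add: regular_codim_growth_def pi_exp_def convergent_LIMSEQ_iff)

theorem corollary1p3:
  fixes A :: "('k::{alg_closed_field, field_char_0}, 'a) module"
    and B :: "nat \<Rightarrow> ('k, 'b) module"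
    and l :: nat
  assumes "fd_algebra A"
    and "1 \<le> l"
    and "\<And>i. i \<in> {1..l} \<Longrightarrow> basic_algebra (B i)"
    and "\<And>i. i \<in> {1..l} \<Longrightarrow> regular_codim_growth (B i)"
    and "pi_equivalent A (prod_algebra {1..l} B)"
  shows "pi_exp A = Max {pi_exp (B i) | i. i \<in> {1..l}} \<and>
    (1 \<le> pi_exp A \<longrightarrow>
      poly_part A = Max {poly_part (B j) | j. j \<in> {1..l} \<and> pi_exp (B j) = pi_exp A})"
proof -
  let ?I = "{1..l}"
  let ?e = "\<lambda>i. pi_exp (B i)"
  let ?b = "\<lambda>i n. real (codim (B i) n)"
  let ?a = "\<lambda>n. real (codim A n)"
  have I: "finite ?I" "?I \<noteq> {}"
    using assms(2) by auto
  have alg: "assoc_algebra (B i)" if "i \<in> ?I" for i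
    using assms(3)[OF that] by (simp add: basic_algebra_def fd_algebra_def)
  have codim_B_le: "codim (B i) n \<le> codim A n" if "i \<in> ?I" "0 < n" for i n
    using that alg assms(5) by (intro codim_ge[OF I]) auto
  have lower: "\<forall>\<^sub>F n in sequentially. ?b i n \<le> ?a n" if "i \<in> ?I" for i
    using eventually_gt_at_top[of 0] by eventually_elim (use codim_B_le that in simp)
  have upper: "\<forall>\<^sub>F n in sequentially. ?a n \<le> (\<Sum>i\<in>?I. ?b i n)"
    using eventually_gt_at_top[of 0]
  proof eventually_elim
    case (elim n)
    show ?case
      unfolding of_nat_sum[symmetric] of_nat_le_iff
      using elim alg assms(5) by (intro codim_le_sum[OF I]) auto
  qed
  have lim: "(\<lambda>n. root n (?b i n)) \<longlonglongrightarrow> ?e i" if "i \<in> ?I" for i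
    using assms(4)[OF that] by (rule regular_codim_growth_root_tendsto)
  have "(\<lambda>n. root n (?a n)) \<longlonglongrightarrow> Max (?e ` ?I)"
    by (rule root_tendsto_Max[where b = ?b, OF I lim lower upper])
  hence exp_A: "pi_exp A = Max (?e ` ?I)"
    unfolding pi_exp_def by (rule limI)
  have part_A: "poly_part A = Max ((\<lambda>j. poly_part (B j)) ` {j\<in>?I. ?e j = pi_exp A})"
    if ge1: "1 \<le> pi_exp A"
  proof -
    let ?J = "{j\<in>?I. ?e j = pi_exp A}"
    have "\<exists>t. is_poly_part (B i) t" if "i \<in> ?I" for i
      using assms(4)[OF that] by (simp add: regular_codim_growth_def)
    then obtain t where t: "\<And>i. i \<in> ?I \<Longrightarrow> is_poly_part (B i) (t i)"
      by metis
    have "0 \<le> ?e i" if "i \<in> ?I" for i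
      using lim[OF that] by (rule LIMSEQ_le_const) (simp add: real_root_ge_zero)
    moreover have "?e i \<le> pi_exp A" if "i \<in> ?I" for i
      unfolding exp_A using that I(1) by simp
    moreover have mem: "pi_exp A \<in> ?e ` ?I"
      unfolding exp_A using I by (intro Max_in) auto
    ultimately have growth: "poly_growth ?a (pi_exp A) (Max (t ` ?J))"
      using t ge1 lower upper
      by (intro poly_growth_Max[where b = ?b]) (auto simp: is_poly_part_iff)
    have "Max (t ` ?J) \<in> t ` ?J"
      using mem by (intro Max_in) auto
    hence "2 * Max (t ` ?J) \<in> \<int>"
      using t by (auto simp: is_poly_part_iff)
    with growth have "poly_part A = Max (t ` ?J)"
      using ge1 by (intro poly_part_eqI) (simp_all add: is_poly_part_iff)
    also have "t ` ?J = (\<lambda>j. poly_part (B j)) ` ?J"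
      using t ge1 by (intro image_cong) (auto intro!: poly_part_eqI[symmetric])
    finally show ?thesis .
  qed
  show ?thesis
    unfolding setcompr_eq_image Collect_mem_eq using exp_A part_A by blast
qed

end
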